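(* Let $p$ be a prime number and $w$ a nonempty word over $[\![p]\!]$. Then the sequence $(a_{p;w}(n))_{n\in\mathbf N}$ is $p$-uniformly morphic, and if $|w|>1$ and $w\neq 10$, it is not purely morphic.
   Context: $[\![p]\!]=\{0,\dots,p-1\}$; $10$ denotes the two-letter word $1\,0$. For $n\ge0$, $[n]_p$ is the base-$p$ expansion of $n$ without leading zeros, with $[0]_p=0$; $e_{p;w}(n)$ is the number of occurrences of $w$ as a factor (contiguous block, counted at every starting position) of $[n]_p$, and $a_{p;w}(n)\in[\![p]\!]$ with $a_{p;w}(n)\equiv e_{p;w}(n)\pmod p$. A morphism $\phi:B^*\to B^*$ is non-erasing if $\phi(b)\neq\varepsilon$ for all letters $b$, $k$-uniform if $|\phi(b)|=k$ for all letters $b$. An infinite sequence $a$ over $A$ is morphic if there are an alphabet $B$, an infinite sequence $b$ over $B$ fixed by a non-erasing morphism $\phi:B^*\to B^*$, and a letter-to-letter map $\psi:B\to A$ with $a=\psi(b)$; $k$-uniformly morphic if $\phi$ can be taken $k$-uniform; purely morphic if one can take $B=A$, $\psi=\mathrm{id}$, i.e. $a$ is a fixed point of a non-erasing morphism $A^*\to A^*$ (here $A=[\![p]\!]$).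
   Formalization: "Fixed by a non-erasing morphism" is taken in the standard sense that φ is prolongable on the first letter, φ(b₀)=b₀u with u nonempty; read literally, the identity morphism would make every sequence purely morphic. Alphabets are finite. *)

theory Defs
  imports "HOL-Computational_Algebra.Primes"
begin

(* Most significant digit first.  For base at least 2 there are no leading zeros,
   and 0 is written as the one-letter word 0. *)
function base_expansion :: "nat \<Rightarrow> nat \<Rightarrow> nat list" where
  "base_expansion p n =
     (if p < 2 \<or> n < p then [n] else base_expansion p (n div p) @ [n mod p])"
  by pat_completeness auto
termination
  by (relation "measure snd") auto

declare base_expansion.simps [simp del]

definition occurrences :: "'a list \<Rightarrow> 'a list \<Rightarrow> nat" where
  "occurrences w u = card {i. i + length w \<le> length u \<and> take (length w) (drop i u) = w}"

definition block_count :: "nat \<Rightarrow> nat list \<Rightarrow> nat \<Rightarrow> nat" where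
  "block_count p w n = occurrences w (base_expansion p n)"

definition block_seq :: "nat \<Rightarrow> nat list \<Rightarrow> nat \<Rightarrow> nat" where
  "block_seq p w n = block_count p w n mod p"

(* A morphism of the free monoid over the alphabet B is given by the images of the letters;
   it is extended to words by concatenation. *)
definition morphism_on :: "'b set \<Rightarrow> ('b \<Rightarrow> 'b list) \<Rightarrow> bool" where
  "morphism_on B \<phi> \<longleftrightarrow> (\<forall>x\<in>B. \<phi> x \<in> lists B)"

definition morph_ext :: "('b \<Rightarrow> 'b list) \<Rightarrow> 'b list \<Rightarrow> 'b list" where
  "morph_ext \<phi> u = concat (map \<phi> u)"

definition nonerasing_on :: "'b set \<Rightarrow> ('b \<Rightarrow> 'b list) \<Rightarrow> bool" where
  "nonerasing_on B \<phi> \<longleftrightarrow> (\<forall>x\<in>B. \<phi> x \<noteq> [])"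

definition uniform_on :: "'b set \<Rightarrow> nat \<Rightarrow> ('b \<Rightarrow> 'b list) \<Rightarrow> bool" where
  "uniform_on B k \<phi> \<longleftrightarrow> (\<forall>x\<in>B. length (\<phi> x) = k)"

definition seq_prefix :: "(nat \<Rightarrow> 'b) \<Rightarrow> nat \<Rightarrow> 'b list" where
  "seq_prefix b n = map b [0..<n]"

(* The infinite sequence phi(b) equals b: the image of every prefix of b is a prefix of b.
   For non-erasing phi the lengths of these images are unbounded, so this determines phi(b). *)
definition fixed_by :: "('b \<Rightarrow> 'b list) \<Rightarrow> (nat \<Rightarrow> 'b) \<Rightarrow> bool" where
  "fixed_by \<phi> b \<longleftrightarrow>
     (\<forall>n. morph_ext \<phi> (seq_prefix b n) = seq_prefix b (length (morph_ext \<phi> (seq_prefix b n))))"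

(* Fixed points are understood in the usual sense of the theory of morphic sequences: phi is
   prolongable on the first letter of b, that is phi(b_0) = b_0 u with u nonempty, so that b is
   the limit of the words phi^n(b_0).  Without this the identity morphism would make every
   sequence over B a fixed point.  For k-uniform phi with k at least 2 it holds automatically. *)
definition prolongable_on :: "('b \<Rightarrow> 'b list) \<Rightarrow> 'b \<Rightarrow> bool" where
  "prolongable_on \<phi> x \<longleftrightarrow> (\<exists>u. u \<noteq> [] \<and> \<phi> x = x # u)"

definition morphic_fixed_point :: "'b set \<Rightarrow> ('b \<Rightarrow> 'b list) \<Rightarrow> (nat \<Rightarrow> 'b) \<Rightarrow> bool" where
  "morphic_fixed_point B \<phi> b \<longleftrightarrow>
     finite B \<and> range b \<subseteq> B \<and> morphism_on B \<phi> \<and> nonerasing_on B \<phi> \<and>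
     prolongable_on \<phi> (b 0) \<and> fixed_by \<phi> b"

(* The auxiliary alphabet B is an arbitrary finite set; its letters are named by natural numbers. *)
definition uniformly_morphic :: "nat \<Rightarrow> 'a set \<Rightarrow> (nat \<Rightarrow> 'a) \<Rightarrow> bool" where
  "uniformly_morphic k A a \<longleftrightarrow>
     (\<exists>(B :: nat set) b \<phi> \<psi>.
        morphic_fixed_point B \<phi> b \<and> uniform_on B k \<phi> \<and> \<psi> ` B \<subseteq> A \<and> (\<forall>n. a n = \<psi> (b n)))"

definition purely_morphic :: "'a set \<Rightarrow> (nat \<Rightarrow> 'a) \<Rightarrow> bool" where
  "purely_morphic A a \<longleftrightarrow> (\<exists>\<phi>. morphic_fixed_point A \<phi> a)"

end

theory Submission
  imports Defs "HOL-Library.Sublist" "HOL-Number_Theory.Cong"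
begin

text \<open>
  Appending a digit to the expansion of \<open>n\<close> adds an occurrence of \<open>w\<close> exactly when the new
  expansion ends in \<open>w\<close>. Hence the block at \<open>p * n\<close> is determined by the value at \<open>n\<close> together
  with the last \<open>|w|\<close> digits of \<open>n\<close>, which gives a \<open>p\<close>-uniform morphism.

  Suppose now that the sequence \<open>a\<close> is a fixed point of \<open>\<phi>\<close>, and let \<open>N\<close> be the least index with
  \<open>a N \<noteq> 0\<close>. As \<open>a\<close> begins with \<open>0\<^sup>N\<close>, it begins with the \<open>N\<close>-th power of \<open>\<phi> 0\<close>, and
  \<open>l = |\<phi> 0| > N\<close>. If \<open>p\<close> divides \<open>l\<close>, then reading \<open>a\<close> along a residue class of indices avoiding the
  last digit of \<open>w\<close> gives a prefix power of the same exponent with period \<open>l / p\<close>. Otherwise, shifting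
  by multiples of \<open>l\<close> moves the first change of value of \<open>a\<close> into a residue class where no such
  change is possible: modulo \<open>p\<close> if \<open>p \<ge> 3\<close>, and modulo \<open>4\<close> if \<open>p = 2\<close>.
\<close>

section \<open>Expansions and occurrences\<close>

lemma base_expansion_less: "n < p \<Longrightarrow> base_expansion p n = [n]"
  by (simp add: base_expansion.simps)

lemma base_expansion_snoc:
  "2 \<le> p \<Longrightarrow> p \<le> n \<Longrightarrow> base_expansion p n = base_expansion p (n div p) @ [n mod p]"
  by (subst base_expansion.simps) simp

lemma last_base_expansion: "2 \<le> p \<Longrightarrow> last (base_expansion p n) = n mod p"
  by (cases "n < p") (simp_all add: base_expansion_less base_expansion_snoc)

lemma occurrences_snoc:
  assumes "w \<noteq> []"
  shows "occurrences w (u @ [d]) = occurrences w u + of_bool (suffix w (u @ [d]))"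
proof -
  let ?S = "{i. i + length w \<le> length u \<and> take (length w) (drop i u) = w}"
  let ?T = "{i. i + length w = length u + 1 \<and> drop i (u @ [d]) = w}"
  have "{i. i + length w \<le> length (u @ [d]) \<and> take (length w) (drop i (u @ [d])) = w} = ?S \<union> ?T"
    using assms by (auto simp: le_Suc_eq)
  moreover have "finite ?S" by (rule finite_subset[of _ "{..length u}"]) auto
  moreover have "?T = (if suffix w (u @ [d]) then {length u + 1 - length w} else {})"
  proof (cases "suffix w (u @ [d])")
    case True
    then obtain v where v: "u @ [d] = v @ w" by (auto simp: suffix_def)
    then have "length u + 1 = length v + length w" by (metis length_append length_append_singleton Suc_eq_plus1)
    with v True show ?thesis by auto
  next
    case False
    moreover have "?T = {}" using False suffix_drop[of _ "u @ [d]"] by blast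
    ultimately show ?thesis by (simp only: if_False)
  qed
  moreover have "?S \<inter> ?T = {}" by auto
  ultimately show ?thesis
    unfolding occurrences_def by (simp add: card_Un_disjoint)
qed

lemma block_count_step:
  assumes "2 \<le> p" "w \<noteq> []" "p \<le> n"
  shows "block_count p w n =
    block_count p w (n div p) + of_bool (suffix w (base_expansion p n))"
  using assms by (simp add: block_count_def base_expansion_snoc[of p n] occurrences_snoc)

lemma block_count_less:
  assumes "length w > 1" "n < p"
  shows "block_count p w n = 0"
  using assms by (simp add: block_count_def occurrences_def base_expansion_less)

lemma suffix_snoc_base_expansion:
  assumes "2 \<le> p" "p \<le> n"
  shows "suffix (w @ [x]) (base_expansion p n) \<longleftrightarrow>
    x = n mod p \<and> suffix w (base_expansion p (n div p))"
  using assms by (simp add: base_expansion_snoc[of p n])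

text \<open>From \<open>p ^ length w\<close> on, expansions have more than \<open>length w\<close>
  digits, so the residue fixes the last \<open>length w\<close> digits, zeros included. Smaller
  numbers may lack some of these zeros.\<close>

lemma suffix_base_expansion_cong:
  assumes "2 \<le> p" "p ^ length w \<le> m" "p ^ length w \<le> n" "[m = n] (mod p ^ length w)"
  shows "suffix w (base_expansion p m) \<longleftrightarrow> suffix w (base_expansion p n)"
  using assms
proof (induction w arbitrary: m n rule: rev_induct)
  case (snoc x w)
  let ?P = "p ^ length w"
  have "m mod (p * ?P) = n mod (p * ?P)"
    using snoc.prems by (simp add: cong_def)
  then have eq: "p * (m div p mod ?P) + m mod p = p * (n div p mod ?P) + n mod p"
    by (simp add: mod_mult2_eq)
  have m0: "m mod p = n mod p"
    using arg_cong[OF eq, of "\<lambda>k. k mod p"] by simp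
  have m1: "m div p mod ?P = n div p mod ?P"
    using eq m0 snoc.prems(1) by simp
  have "?P \<le> m div p" "?P \<le> n div p"
    using snoc.prems by (simp_all add: less_eq_div_iff_mult_less_eq mult.commute)
  moreover have "p \<le> m" "p \<le> n"
    using snoc.prems by (auto intro: order_trans[rotated])
  ultimately show ?case
    using snoc.IH[of "m div p" "n div p"] snoc.prems(1) m0 m1
    by (simp add: suffix_snoc_base_expansion cong_def)
qed simp

lemma suffix_base_expansion_mod_square:
  assumes "2 \<le> p" "suffix (w @ [y, x]) (base_expansion p n)"
  shows "n mod p\<^sup>2 = p * y + x"
proof (cases "n < p")
  case True
  then show ?thesis
    using assms suffix_length_le[OF assms(2)] by (simp add: base_expansion_less)
next
  case False
  then have "x = n mod p" and s: "suffix (w @ [y]) (base_expansion p (n div p))"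
    using assms suffix_snoc_base_expansion[of p n "w @ [y]" x] by auto
  moreover have "y = n div p mod p"
    using last_base_expansion[OF assms(1), of "n div p"] s by (auto simp: suffix_def)
  ultimately show ?thesis by (simp add: power2_eq_square mod_mult2_eq)
qed

lemma ex_suffix_base_expansion:
  assumes "2 \<le> p" "set w \<subseteq> {0..<p}"
  shows "\<exists>n>0. suffix w (base_expansion p n)"
  using assms(2)
proof (induction w rule: rev_induct)
  case (snoc x w)
  \<comment> \<open>Positivity gives \<open>p * n + x \<ge> p\<close>, so \<open>x\<close> really
    extends the expansion of \<open>n\<close>; words with leading zeros are reached too.\<close>
  then obtain n where "n > 0" "suffix w (base_expansion p n)" by auto
  with snoc.prems assms(1) have "suffix (w @ [x]) (base_expansion p (p * n + x))"
    by (subst suffix_snoc_base_expansion) (auto simp: trans_le_add1)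
  with \<open>n > 0\<close> assms(1) show ?case by (intro exI[of _ "p * n + x"]) simp
qed auto

section \<open>Uniform morphicity\<close>

lemma seq_prefix_mult_Suc:
  "seq_prefix b (k * Suc n) = seq_prefix b (k * n) @ map (\<lambda>d. b (k * n + d)) [0..<k]"
proof -
  have "[0..<k * Suc n] = [0..<k * n] @ map (\<lambda>d. d + k * n) [0..<k]"
    using upt_add_eq_append[of 0 "k * n" k] by (simp add: map_add_upt add.commute)
  then show ?thesis by (simp add: seq_prefix_def add.commute)
qed

text \<open>The values of \<open>b\<close> serve as letters. By \<open>step\<close> a letter
  determines the block of length \<open>k\<close> below it, so the image of a letter can be read off
  at any index where it occurs.\<close>

lemma uniformly_morphicI:
  fixes b :: "nat \<Rightarrow> nat"
  assumes "2 \<le> k" "finite (range b)"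
    and step: "\<And>m n d. b m = b n \<Longrightarrow> d < k \<Longrightarrow> b (k * m + d) = b (k * n + d)"
    and "\<And>n. a n = \<psi> (b n)" "range a \<subseteq> A"
  shows "uniformly_morphic k A a"
proof -
  define \<phi> where "\<phi> x = map (\<lambda>d. b (k * (SOME m. b m = x) + d)) [0..<k]" for x
  have \<phi>: "\<phi> (b n) = map (\<lambda>d. b (k * n + d)) [0..<k]" for n
  proof -
    have "b (SOME m. b m = b n) = b n" by (rule someI[of _ n]) simp
    then show ?thesis by (auto simp: \<phi>_def intro: step)
  qed
  have prefix: "morph_ext \<phi> (seq_prefix b n) = seq_prefix b (k * n)" for n
  proof (induction n)
    case (Suc n)
    have "morph_ext \<phi> (seq_prefix b (Suc n)) = morph_ext \<phi> (seq_prefix b n) @ \<phi> (b n)"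
      by (simp add: morph_ext_def seq_prefix_def)
    with Suc show ?case by (simp only: \<phi> seq_prefix_mult_Suc)
  qed (simp add: morph_ext_def seq_prefix_def)
  have "fixed_by \<phi> b"
    unfolding fixed_by_def prefix by (simp add: seq_prefix_def)
  moreover have "prolongable_on \<phi> (b 0)"
    using assms(1) unfolding prolongable_on_def \<phi> by (simp add: upt_conv_Cons)
  moreover have "morphism_on (range b) \<phi>" "nonerasing_on (range b) \<phi>" "uniform_on (range b) k \<phi>"
    using assms(1) by (auto simp: morphism_on_def nonerasing_on_def uniform_on_def \<phi>)
  moreover have "\<psi> ` range b \<subseteq> A" using assms(4,5) by auto
  ultimately show ?thesis
    using assms(2,4) unfolding uniformly_morphic_def morphic_fixed_point_def by blast
qed

lemma uniformly_morphic_block_seq: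
  assumes "2 \<le> p" "w \<noteq> []"
  shows "uniformly_morphic p {0..<p} (block_seq p w)"
proof -
  define P where "P = p ^ length w"
  \<comment> \<open>Small indices are stored exactly, since there the residue need not decide the
    suffix; the offset \<open>P\<close> keeps the two ranges of values apart.\<close>
  define s where "s n = (if n < P then n else P + n mod P)" for n
  \<comment> \<open>The pair of \<open>block_seq p w n\<close> and \<open>s n\<close>, coded as
    remainder and quotient by \<open>p\<close>.\<close>
  define b where "b n = block_seq p w n + p * s n" for n
  have P: "P > 0" "p \<le> P" using assms by (auto simp: P_def intro: self_le_power simp: Suc_leI)
  have a_less: "block_seq p w n < p" for n using assms by (simp add: block_seq_def)
  have b_mod: "b n mod p = block_seq p w n" and b_div: "b n div p = s n" for n
    using a_less[of n] by (simp_all add: b_def)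
  show ?thesis
  proof (rule uniformly_morphicI[where b = b and \<psi> = "\<lambda>x. x mod p"])
    have "b n < p + p * (2 * P)" for n
    proof -
      have "s n \<le> 2 * P" using P(1) by (simp add: s_def mult_2 less_imp_le)
      then have "p * s n \<le> p * (2 * P)" by simp
      with a_less[of n] show ?thesis unfolding b_def by linarith
    qed
    then have "range b \<subseteq> {..<p + p * (2 * P)}" by auto
    then show "finite (range b)" by (rule finite_subset) simp
  next
    fix m n d
    assume eq: "b m = b n" and d: "d < p"
    show "b (p * m + d) = b (p * n + d)"
    proof (cases "m = n")
      case False
      \<comment> \<open>\<open>s\<close> is injective below \<open>P\<close> and at least
        \<open>P\<close> from there on, so distinct indices with equal letters both lie in the range
        where residues suffice.\<close>
      have s: "s m = s n" and a: "block_seq p w m = block_seq p w n"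
        using eq b_div b_mod by metis+
      with False P(1) have ge: "P \<le> m" "P \<le> n" and "m mod P = n mod P"
        by (auto simp: s_def split: if_splits)
      then have cong: "[p * m + d = p * n + d] (mod P)"
        by (simp add: cong_add cong_scalar_left cong_def[of m n])
      have le: "k \<le> p * k + d" for k
        using assms(1) by (metis le_add1 le_trans mult_le_mono1 mult_1 one_le_numeral)
      have ge': "P \<le> p * m + d" "P \<le> p * n + d"
        using ge le order_trans by blast+
      have "suffix w (base_expansion p (p * m + d)) = suffix w (base_expansion p (p * n + d))"
        using suffix_base_expansion_cong[OF assms(1)] ge' cong unfolding P_def by blast
      moreover have "block_seq p w (p * k + d) =
          (block_seq p w k + of_bool (suffix w (base_expansion p (p * k + d)))) mod p"
        if "P \<le> p * k + d" for k
        using block_count_step[OF assms, of "p * k + d"] that P(2) d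
        by (simp add: block_seq_def mod_add_left_eq)
      ultimately have "block_seq p w (p * m + d) = block_seq p w (p * n + d)"
        using a ge' by simp
      moreover have "s (p * m + d) = s (p * n + d)"
        using ge' cong by (simp add: s_def cong_def)
      ultimately show ?thesis by (simp add: b_def)
    qed simp
  qed (use assms a_less b_mod in auto)
qed

section \<open>Failure of pure morphicity\<close>

text \<open>
  \<open>I n\<close> marks the indices at which a new occurrence is completed. That these lie in one residue
  class modulo \<open>p\<^sup>2\<close> is all that is needed about words of length at least \<open>2\<close>.
\<close>

locale block_recurrence =
  fixes p :: nat and a :: "nat \<Rightarrow> nat" and I :: "nat \<Rightarrow> bool" and v :: nat
  assumes prime_p: "prime p"
    and step: "a n = (a (n div p) + of_bool (I n)) mod p"
    and I_mod: "I n \<Longrightarrow> n mod p\<^sup>2 = v"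
    and a_small: "n < p \<Longrightarrow> a n = 0"
    and ex_I: "\<exists>n. I n"
begin

definition N :: nat where "N = (LEAST n. a n \<noteq> 0)"

lemma p_ge_2: "2 \<le> p"
  using prime_p by (rule prime_ge_2_nat)

lemma I_mod_p: "I n \<Longrightarrow> n mod p = v mod p"
  using I_mod[of n] by (metis dvd_triv_left mod_mod_cancel power2_eq_square)

lemma a_N: "a N \<noteq> 0"
proof -
  obtain n where "I n" using ex_I by blast
  then have "a n \<noteq> 0 \<or> a (n div p) \<noteq> 0"
    using step[of n] p_ge_2 by (cases "a (n div p) = 0") auto
  then show ?thesis unfolding N_def by (metis (mono_tags, lifting) LeastI)
qed

lemma a_less_N: "n < N \<Longrightarrow> a n = 0"
  using not_less_Least unfolding N_def by blast

lemma p_le_N: "p \<le> N"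
  using a_N a_small[of N] by (cases "p \<le> N") simp_all

lemma N_div_less: "N div p < N"
  using p_le_N p_ge_2 by simp

text \<open>The recurrence at \<open>N\<close> starts from the value 0 at \<open>N div p\<close>, so
  only a new occurrence can make \<open>a N\<close> nonzero.\<close>

lemma I_N: "I N"
  using step[of N] a_N a_less_N[OF N_div_less] by (cases "I N") auto

lemma a_N_eq: "a N = 1"
  using step[of N] I_N a_less_N[OF N_div_less] p_ge_2 by simp

lemma no_coprime_prefix_power:
  assumes "2 < N" "N < l" "\<not> p dvd l"
    and per: "\<And>n j. n < l \<Longrightarrow> j < N \<Longrightarrow> a (j * l + n) = a n"
  shows False
proof (cases "p = 2")
  case False
  then have p3: "3 \<le> p" using p_ge_2 by simp
  \<comment> \<open>A residue with \<open>c + 1 < p\<close> and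
    \<open>c + 1 \<noteq> v mod p\<close>: indices congruent to \<open>c\<close> and
    \<open>c + 1\<close> can share a quotient by \<open>p\<close>, and no occurrence is completed at
    the second one.\<close>
  define c :: nat where "c = (if v mod p = 1 then 1 else 0)"
  have "coprime l p"
    using prime_imp_coprime[OF prime_p assms(3)] by (simp add: coprime_commute)
  then obtain u where u: "[l * u = 1] (mod p)"
    using cong_solve_coprime_nat by auto
  \<comment> \<open>Solves \<open>j * l + (N - 1) = c\<close> modulo \<open>p\<close>, with
    \<open>(p - 1) * (N - 1)\<close> in place of \<open>-(N - 1)\<close>. Reducing modulo
    \<open>p\<close> ensures \<open>j < p \<le> N\<close>, so \<open>per\<close> applies.\<close>
  define j where "j = (u * (c + (p - 1) * (N - 1))) mod p"
  have "j < p" using p3 by (simp add: j_def)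
  define t where "t = j * l + (N - 1)"
  have "[t = u * (c + (p - 1) * (N - 1)) * l + (N - 1)] (mod p)"
    unfolding t_def by (intro cong_add cong_mult cong_refl) (simp add: j_def cong_def)
  also have "u * (c + (p - 1) * (N - 1)) * l = (l * u) * (c + (p - 1) * (N - 1))"
    by (simp add: ac_simps)
  also have "[(l * u) * (c + (p - 1) * (N - 1)) + (N - 1) = 1 * (c + (p - 1) * (N - 1)) + (N - 1)] (mod p)"
    using u by (intro cong_add cong_mult cong_refl)
  also have "1 * (c + (p - 1) * (N - 1)) + (N - 1) = c + p * (N - 1)"
    using p3 by (cases p) simp_all
  finally have "t mod p = c" using p3 by (simp add: cong_def c_def split: if_splits)
  have div: "Suc t div p = t div p" and mod: "Suc t mod p = Suc c"
    using \<open>t mod p = c\<close> p3 by (auto simp: div_Suc mod_Suc c_def)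
  have "\<not> I (Suc t)"
    using I_mod_p[of "Suc t"] mod by (auto simp: c_def split: if_splits)
  then have "a (Suc t) = a (t div p) mod p"
    using step[of "Suc t"] div by simp
  moreover have "a (Suc t) = 1" "a t = 0"
    using per[of N j] per[of "N - 1" j] \<open>j < p\<close> p_le_N assms(1,2) a_N_eq a_less_N[of "N - 1"]
    by (simp_all add: t_def)
  moreover have "a t = (a (t div p) + of_bool (I t)) mod p" by (rule step)
  \<comment> \<open>The step from 0 to 1 would need \<open>1\<close> or \<open>2\<close> to vanish
    modulo \<open>p\<close>, which \<open>p \<ge> 3\<close> forbids.\<close>
  ultimately have "(1 + of_bool (I t)) mod p = (0::nat)"
    by (metis mod_add_left_eq)
  then show False using p3 by (cases "I t") auto
next
  case p: True
  define x where "x = v mod 2"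
  have x: "N mod 2 = x" using I_mod_p[OF I_N] p by (simp add: x_def)
  \<comment> \<open>The even member of the pair of indices that contains \<open>N\<close> and shares
    one quotient by 2.\<close>
  define n where "n = N - x"
  have n: "n + x = N" "even n"
    using assms(1) unfolding n_def x[symmetric] by (simp_all add: minus_mod_eq_mult_div)
  have x01: "x = 0 \<or> x = 1" by (auto simp: x_def)
  have shift_ne: "a (Suc n) \<noteq> a n"
  proof (cases "x = 0")
    case True
    have "\<not> I (Suc N)"
      using I_mod_p[of "Suc N"] p True x x_def by (auto simp: mod_Suc)
    then have "a (Suc N) = 0"
      using step[of "Suc N"] True x p a_less_N[OF N_div_less] by (simp add: div_Suc mod_Suc)
    then show ?thesis using n True a_N_eq by simp
  next
    case False
    then show ?thesis using n x01 a_N_eq a_less_N[of n] by auto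
  qed
  have I_of_change: "I (t + x)" if "even t" "a (Suc t) \<noteq> a t" for t
  proof -
    have "Suc t div 2 = t div 2" using that(1) by simp
    then have "I (Suc t) \<noteq> I t"
      using step[of t] step[of "Suc t"] that(2) p by (cases "I t"; cases "I (Suc t)") simp_all
    moreover have "\<not> I (t + (1 - x))"
    proof
      assume "I (t + (1 - x))"
      then have "(t + (1 - x)) mod 2 = x" using I_mod_p p by (simp add: x_def)
      then show False using x01 that(1) by (elim disjE) (simp_all, presburger)
    qed
    ultimately show ?thesis using x01 by auto
  qed
  \<comment> \<open>An even multiple of \<open>l\<close> preserves parity, so the change within the
    pair reappears there and forces \<open>I\<close> at two indices \<open>2 * l\<close> apart.
    These agree modulo 4 only if \<open>l\<close> is even.\<close>
  have "a (2 * l + n) = a n" using per[of n 2] assms(1,2) n by simp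
  moreover have "a (Suc (2 * l + n)) = a (Suc n)"
  proof (cases "Suc n < l")
    case True
    then show ?thesis using per[of "Suc n" 2] assms(1) by simp
  next
    case False
    \<comment> \<open>At this boundary the second index of the shifted pair is \<open>3 * l\<close>,
      so exponent 3 is required; \<open>N\<close> is even here, hence at least 4.\<close>
    then have "Suc n = l" "x = 0" using assms(2) n x01 by auto
    moreover have "3 < N" using assms(1) \<open>x = 0\<close> x by (cases "N = 3") auto
    moreover have "Suc (2 * l + n) = 3 * l" using \<open>Suc n = l\<close> by simp
    then have "a (Suc (2 * l + n)) = a (3 * l)" by (rule arg_cong)
    ultimately show ?thesis
      using per[of 0 3] per[of 0 1] assms(1,2) by simp
  qed
  ultimately have "I (2 * l + n + x)"
    using I_of_change[of "2 * l + n"] shift_ne n by simp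
  moreover have "I (n + x)" using I_of_change[of n] shift_ne n by simp
  ultimately have "(2 * l + n + x) mod 4 = (n + x) mod 4"
    using I_mod[of "2 * l + n + x"] I_mod[of "n + x"] p by simp
  then have "even l" by presburger
  with assms(3) p show False by simp
qed

lemma no_prefix_power:
  assumes "2 < N" "N < l" "\<And>n j. n < l \<Longrightarrow> j < N \<Longrightarrow> a (j * l + n) = a n"
  shows False
  using assms(2,3)
proof (induction l rule: less_induct)
  case (less l)
  show ?case
  proof (cases "p dvd l")
    case False
    then show ?thesis using no_coprime_prefix_power assms(1) less.prems by blast
  next
    case True
    then obtain l' where l': "l = p * l'" by blast
    \<comment> \<open>A digit other than the last digit of \<open>w\<close>: appending it completes
      no occurrence, so \<open>a\<close> survives the passage from \<open>m\<close> to
      \<open>p * m + d\<close>.\<close>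
    define d :: nat where "d = (if v mod p = 0 then 1 else 0)"
    have d: "d < p" "d \<noteq> v mod p" using p_ge_2 by (auto simp: d_def)
    have a_d: "a (p * m + d) = a m" for m
    proof -
      have "\<not> I (p * m + d)" using I_mod_p[of "p * m + d"] d by auto
      moreover have "a m < p" using step[of m] p_ge_2 by simp
      ultimately show ?thesis using step[of "p * m + d"] d by simp
    qed
    have per: "a (j * l' + n) = a n" if "n < l'" "j < N" for n j
    proof -
      have "p * n + d < p * Suc n" using d by simp
      also have "\<dots> \<le> l" unfolding l' using that(1) by (intro mult_le_mono2) simp
      finally have "a (j * l + (p * n + d)) = a (p * n + d)" using less.prems(2) that(2) by blast
      moreover have "j * l + (p * n + d) = p * (j * l' + n) + d"
        by (simp add: l' algebra_simps)
      ultimately show ?thesis by (simp add: a_d)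
    qed
    have "l' > 0" using less.prems(1) l' by (cases l') auto
    show ?thesis
    proof (cases "N < l'")
      case True
      moreover have "l' < l" using l' \<open>l' > 0\<close> p_ge_2 by simp
      ultimately show ?thesis using less.IH per by blast
    next
      case False
      \<comment> \<open>If the descent overshoots to \<open>l' \<le> N\<close>, periodicity moves
        \<open>N\<close> to a smaller index, where \<open>a\<close> is 0. The exponent is too small
        for this only if \<open>l' = 1\<close>, but then \<open>l = p \<le> N\<close>.\<close>
      have "N div l' < N \<or> l' = 1" using \<open>l' > 0\<close> assms(1) by auto
      then show ?thesis
      proof
        assume "N div l' < N"
        then have "a (N div l' * l' + N mod l') = a (N mod l')"
          using \<open>l' > 0\<close> by (intro per) simp_all
        moreover have "N mod l' < N" using False \<open>l' > 0\<close>
          by (meson mod_less_divisor not_less order_less_le_trans)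
        ultimately show False using a_N a_less_N by simp
      next
        assume "l' = 1"
        then show False using l' less.prems(1) p_le_N by simp
      qed
    qed
  qed
qed

lemma not_purely_morphic:
  assumes "2 < N"
  shows "\<not> purely_morphic A a"
proof
  assume "purely_morphic A a"
  then obtain \<phi> where pro: "prolongable_on \<phi> (a 0)" and fixed: "fixed_by \<phi> a"
    by (auto simp: purely_morphic_def morphic_fixed_point_def)
  have a0: "a 0 = 0" using a_small p_ge_2 by simp
  define l where "l = length (\<phi> 0)"
  have l: "2 \<le> l"
    using pro by (auto simp: prolongable_on_def a0 l_def Suc_le_eq)
  have ext: "seq_prefix a (k * l) = concat (replicate k (\<phi> 0))" if "k \<le> N" for k
  proof -
    have "seq_prefix a k = replicate k 0"
      using that a_less_N by (auto simp: seq_prefix_def intro!: nth_equalityI)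
    then have *: "morph_ext \<phi> (seq_prefix a k) = concat (replicate k (\<phi> 0))"
      by (simp add: morph_ext_def)
    moreover have "length (concat (replicate k (\<phi> 0))) = k * l"
      by (simp add: length_concat l_def sum_list_replicate)
    ultimately show ?thesis using fixed unfolding fixed_by_def by metis
  qed
  have \<phi>0: "\<phi> 0 = seq_prefix a l" using ext[of 1] assms by simp
  have per: "a (j * l + n) = a n" if "n < l" "j < N" for n j
  proof -
    have "seq_prefix a (Suc j * l) = seq_prefix a (j * l) @ seq_prefix a l"
      using ext[of j] ext[of "Suc j"] that(2) \<phi>0
      by (simp add: replicate_append_same[symmetric])
    then have "seq_prefix a (Suc j * l) ! (j * l + n) = seq_prefix a l ! n"
      by (simp add: nth_append seq_prefix_def)
    then show ?thesis using that(1) by (simp add: seq_prefix_def)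
  qed
  \<comment> \<open>Otherwise the \<open>N\<close> copies of \<open>\<phi> 0\<close> reach past
    \<open>N\<close>, and periodicity equates \<open>a N\<close> with the zero at
    \<open>N mod l\<close>.\<close>
  have "N < l"
  proof (rule ccontr)
    assume "\<not> N < l"
    then have "N mod l < N" using l
      by (intro less_le_trans[of "N mod l" l N]) simp_all
    moreover have "N div l < N" using l assms by simp
    then have "a (N div l * l + N mod l) = a (N mod l)" using l by (intro per) simp_all
    ultimately show False using a_N a_less_N by simp
  qed
  then show False using no_prefix_power assms per by blast
qed

end

theorem theorem13:
  fixes p :: nat and w :: "nat list"
  assumes "prime p"
    and "w \<noteq> []"
    and "set w \<subseteq> {0..<p}"
  shows "uniformly_morphic p {0..<p} (block_seq p w) \<and>
    (length w > 1 \<and> w \<noteq> [1, 0] \<longrightarrow> \<not> purely_morphic {0..<p} (block_seq p w))"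
proof (intro conjI impI)
  have p: "2 \<le> p" using assms(1) by (rule prime_ge_2_nat)
  show "uniformly_morphic p {0..<p} (block_seq p w)"
    using uniformly_morphic_block_seq p assms(2) .
  assume w: "length w > 1 \<and> w \<noteq> [1, 0]"
  define I where "I n = suffix w (base_expansion p n)" for n
  obtain w' y x where w': "w = w' @ [y, x]"
    using w by (cases w rule: rev_cases; cases "butlast w" rule: rev_cases) auto
  have small: "block_seq p w n = 0" if "n < p" for n
    using block_count_less w that by (simp add: block_seq_def)
  interpret block_recurrence p "block_seq p w" I "p * y + x"
  proof
    fix n
    show "block_seq p w n = (block_seq p w (n div p) + of_bool (I n)) mod p"
    proof (cases "n < p")
      case True
      then have "\<not> I n"
        using w suffix_length_le[of w "[n]"] by (auto simp: I_def base_expansion_less)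
      with True show ?thesis using small p by simp
    next
      case False
      then show ?thesis
        using block_count_step[OF p assms(2), of n]
        by (simp add: block_seq_def I_def mod_add_left_eq)
    qed
  next
    show "\<exists>n. I n" using ex_suffix_base_expansion[OF p assms(3)] by (auto simp: I_def)
  next
    fix n
    assume "I n"
    then show "n mod p\<^sup>2 = p * y + x"
      using suffix_base_expansion_mod_square[OF p] by (simp add: I_def w')
  qed (use assms small in auto)
  \<comment> \<open>Here \<open>w \<noteq> [1, 0]\<close> enters: for \<open>p = 2\<close>, the
    value \<open>N = 2\<close> would make \<open>w\<close> a suffix of 10 of length at least
    2.\<close>
  have "2 < N"
  proof (cases "p = 2")
    case True
    have "base_expansion 2 2 = [1, 0]"
      by (simp add: base_expansion_snoc base_expansion_less)
    then have "\<not> I 2"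
      using True w by (auto simp: I_def suffix_Cons)
    then have "N \<noteq> 2" using I_N by auto
    then show ?thesis using p_le_N True by simp
  next
    case False
    then show ?thesis using p p_le_N by simp
  qed
  then show "\<not> purely_morphic {0..<p} (block_seq p w)" by (rule not_purely_morphic)
qed

end
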